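(* Let $\zeta$ be a substitution on $\{0,1\}$ and let $u\in\{0,1\}^{\mathbb{N}}$ be a fixed point of $\zeta$ (starting with $0$), so that $u=\lim_{n\to\infty}\zeta^n(0)$. Then $u$ has an at most spacer rank-two construction.
   Context: Substitutions: $\{0,1\}^{<\mathbb{N}}$ denotes the set of finite binary words. A substitution is a function $\zeta:\{0,1\}\to\{0,1\}^{<\mathbb{N}}$, extended to finite and infinite words by $\zeta(w_0w_1w_2\cdots)=\zeta(w_0)\zeta(w_1)\zeta(w_2)\cdots$. Standing assumptions: $\zeta(0)$ starts with $0$ and has length greater than $1$, and $\lim_{n\to\infty}|\zeta^n(1)|=\infty$. There is then a unique $u\in\{0,1\}^{\mathbb{N}}$ starting with $0$ with $\zeta(u)=u$, namely $u=\lim_{n\to\infty}\zeta^n(0)$; all fixed points considered start with $0$. Building: $\mathbb{N}$ is the set of nonnegative integers; $\mathcal{F}$ is the set of all finite words that start and end with $0$; $1^a$ is $a$ consecutive $1$s. For finite $S\subset\mathcal{F}$, a finite word $w$ is built from $S$ if $w=v_11^{a_1}v_21^{a_2}\cdots v_k1^{a_k}v_{k+1}$ for some $k\ge 1$, $v_i\in S$, $a_i\in\mathbb{N}$; it is built from $S$ starting with $u$ if moreover one can take $v_1=u$. An infinite word $V$ has an at most spacer rank-$n$ construction if there are finite sets $S_i=\{v_{i,1},\dots,v_{i,n_i}\}\subset\mathcal{F}$ ($i\in\mathbb{N}$) with $1\le n_i\le n$ such that: $v_{0,j}=0$ for all $j$; $v_{i+1,1}$ is built from $S_i$ starting with $v_{i,1}$;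 $v_{i+1,j}$ is built from $S_i$ for all $2\le j\le n_{i+1}$; and $v_{i,1}$ is an initial segment of $V$ for all $i$.
   Formalization: The fixed point u = 0111… is excluded: it is fixed by 0→01, 1→11, which meets all standing assumptions, but since k ≥ 1 the word v_{1,1} must contain two zeros, so 0111… has no spacer construction of any rank. *)

theory Defs
  imports Complex_Main "HOL-Library.Z2" "HOL-Library.Stream"
begin

text \<open>
  Letters are the elements \<open>0\<close>, \<open>1\<close> of the two-element type \<^typ>\<open>bit\<close>; finite words are lists and
  infinite words are streams.
\<close>

definition subst_word :: "(bit \<Rightarrow> bit list) \<Rightarrow> bit list \<Rightarrow> bit list" where
  "subst_word \<zeta> w = concat (map \<zeta> w)"

text \<open>
  The library function \<^const>\<open>flat\<close> is infinite concatenation only for streams of nonempty lists. If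
  the lengths of the iterates of \<open>\<zeta>\<close> on \<open>1\<close> tend to infinity, then \<open>\<zeta> 1\<close> is nonempty.
\<close>

definition subst_stream :: "(bit \<Rightarrow> bit list) \<Rightarrow> bit stream \<Rightarrow> bit stream" where
  "subst_stream \<zeta> u = flat (smap \<zeta> u)"

definition zero_ended_words :: "bit list set" where
  "zero_ended_words = {w. w \<noteq> [] \<and> hd w = 0 \<and> last w = 0}"

text \<open>\<open>w = v\<^sub>1 1\<^bsup>a\<^sub>1\<^esup> v\<^sub>2 1\<^bsup>a\<^sub>2\<^esup> \<dots> v\<^sub>k 1\<^bsup>a\<^sub>k\<^esup> v\<^bsub>k+1\<^esub>\<close>, indices starting at \<open>1\<close>.\<close>

definition spacer_decomposition ::
    "bit list set \<Rightarrow> bit list \<Rightarrow> nat \<Rightarrow> (nat \<Rightarrow> bit list) \<Rightarrow> (nat \<Rightarrow> nat) \<Rightarrow> bool" where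
  "spacer_decomposition S w k v a \<longleftrightarrow>
     1 \<le> k \<and> (\<forall>i\<in>{1..k+1}. v i \<in> S) \<and>
     w = concat (map (\<lambda>i. v i @ replicate (a i) 1) [1..<k+1]) @ v (k+1)"

definition built_from :: "bit list set \<Rightarrow> bit list \<Rightarrow> bool" where
  "built_from S w \<longleftrightarrow> (\<exists>k v a. spacer_decomposition S w k v a)"

definition built_from_starting_with :: "bit list set \<Rightarrow> bit list \<Rightarrow> bit list \<Rightarrow> bool" where
  "built_from_starting_with S x w \<longleftrightarrow> (\<exists>k v a. spacer_decomposition S w k v a \<and> v 1 = x)"

definition initial_segment :: "bit list \<Rightarrow> bit stream \<Rightarrow> bool" where
  "initial_segment w V \<longleftrightarrow> stake (length w) V = w"

text \<open>
  \<open>v i j\<close> for \<open>1 \<le> j \<le> N i\<close> enumerates \<open>S\<^sub>i\<close>, possibly with repetitions; values of \<open>v i\<close> at other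
  indices are irrelevant.
\<close>

definition at_most_spacer_rank :: "nat \<Rightarrow> bit stream \<Rightarrow> bool" where
  "at_most_spacer_rank n V \<longleftrightarrow>
     (\<exists>(N :: nat \<Rightarrow> nat) (v :: nat \<Rightarrow> nat \<Rightarrow> bit list).
        (\<forall>i. 1 \<le> N i \<and> N i \<le> n) \<and>
        (\<forall>i. v i ` {1..N i} \<subseteq> zero_ended_words) \<and>
        (\<forall>j\<in>{1..N 0}. v 0 j = [0]) \<and>
        (\<forall>i. built_from_starting_with (v i ` {1..N i}) (v i 1) (v (i+1) 1)) \<and>
        (\<forall>i. \<forall>j\<in>{2..N (i+1)}. built_from (v i ` {1..N i}) (v (i+1) j)) \<and>
        (\<forall>i. initial_segment (v i 1) V))"

text \<open>
  As \<open>k \<ge> 1\<close>, every \<open>v\<^bsub>i+1,1\<^esub>\<close> contains at least two zeros. Hence the word \<open>0111\<dots>\<close> has no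
  construction of any rank, although the substitution \<open>0 \<mapsto> 01\<close>, \<open>1 \<mapsto> 11\<close> fixes it and satisfies all
  standing assumptions. This one fixed point therefore has to be excluded from the theorem.
\<close>

lemma not_at_most_spacer_rank_zero_ones: "\<not> at_most_spacer_rank n (0 ## sconst 1)"
proof
  assume "at_most_spacer_rank n (0 ## sconst 1)"
  then obtain N :: "nat \<Rightarrow> nat" and v where
      N: "\<forall>i. 1 \<le> N i \<and> N i \<le> n" and F: "\<forall>i. v i ` {1..N i} \<subseteq> zero_ended_words"
    and B: "\<forall>i. built_from_starting_with (v i ` {1..N i}) (v i 1) (v (i+1) 1)"
    and I: "\<forall>i. initial_segment (v i 1) (0 ## sconst 1)"
    unfolding at_most_spacer_rank_def by (elim exE conjE) rule
  define w where "w = v 1 1"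
  have "w \<in> v 1 ` {1..N 1}"
    unfolding w_def using N by (intro imageI) simp
  then have "w \<in> zero_ended_words"
    by (rule subsetD[OF spec[OF F]])
  then have w: "w \<noteq> []" "last w = 0"
    unfolding zero_ended_words_def by blast+
  obtain k x a where d: "spacer_decomposition (v 0 ` {1..N 0}) w k x a"
    using spec[OF B, of 0] unfolding built_from_starting_with_def w_def add_0 by blast
  have k: "1 \<le> k" and x: "\<forall>i\<in>{1..k+1}. x i \<in> v 0 ` {1..N 0}"
    and w_eq: "w = concat (map (\<lambda>i. x i @ replicate (a i) 1) [1..<k+1]) @ x (k+1)"
    using d unfolding spacer_decomposition_def by blast+
  have ne: "x i \<noteq> []" if "i \<in> {1..k+1}" for i
    using subsetD[OF spec[OF F] bspec[OF x that]] unfolding zero_ended_words_def by blast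
  have "[1..<k+1] = 1 # [2..<k+1]"
    using k upt_conv_Cons[of 1 "k+1"] by (simp add: numeral_2_eq_2 del: upt_Suc)
  then have "length w = length (x 1) + length (x (k+1))
      + (a 1 + length (concat (map (\<lambda>i. x i @ replicate (a i) 1) [2..<k+1])))"
    unfolding w_eq by (simp del: upt_Suc)
  moreover have "length (x 1) > 0" "length (x (k+1)) > 0"
    using ne[of 1] ne[of "k+1"] by simp_all
  ultimately have len: "length w \<ge> 2"
    by linarith
  then obtain m where m: "length w - 1 = Suc m"
    by (cases "length w - 1") auto
  have "last w = w ! (length w - 1)"
    using w(1) by (rule last_conv_nth)
  also have "\<dots> = stake (length w) (0 ## sconst 1) ! (length w - 1)"
    using spec[OF I, of 1] unfolding initial_segment_def w_def by (simp only:)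
  also have "\<dots> = (0 ## sconst 1) !! (length w - 1)"
    using len by (intro stake_nth) linarith
  also have "\<dots> = 1"
    unfolding m by simp
  finally show False
    using w(2) by simp
qed

lemma zero_ones_fixed_point:
  defines "\<zeta> \<equiv> \<lambda>b::bit. if b = 0 then [0, 1] else [1, 1]"
  shows "subst_stream \<zeta> (0 ## sconst 1) = 0 ## sconst 1"
    and "filterlim (\<lambda>n. length ((subst_word \<zeta> ^^ n) [1])) at_top sequentially"
proof -
  have z: "\<zeta> 0 = [0, 1]" "\<zeta> 1 = [1, 1]"
    by (simp_all add: \<zeta>_def)
  have "sset (flat (sconst (\<zeta> 1))) = {1}"
    unfolding z by (subst sset_flat) simp_all
  then have f: "flat (sconst (\<zeta> 1)) = sconst 1"
    by (simp only: sconst_alt)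
  have s: "1 ## sconst 1 = (sconst 1 :: bit stream)"
    using siterate.ctr[of id "1::bit"] by simp
  show "subst_stream \<zeta> (0 ## sconst 1) = 0 ## sconst 1"
    using f by (simp add: subst_stream_def smap_sconst z s)
  have *: "subst_word \<zeta> (replicate m 1) = replicate (2 * m) 1" for m
    by (induction m) (simp_all add: subst_word_def z)
  have it: "(subst_word \<zeta> ^^ n) [1] = replicate (2 ^ n) 1" for n
    by (induction n) (simp_all add: *)
  show "filterlim (\<lambda>n. length ((subst_word \<zeta> ^^ n) [1])) at_top sequentially"
    unfolding it length_replicate
    by (rule filterlim_at_top_mono[OF filterlim_ident])
       (intro always_eventually allI less_imp_le less_exp)
qed

end

theory Submission
  imports Defs
begin

text \<open>
  Strip the outer ones off the iterates \<open>\<zeta>\<^sup>n(0)\<close> and \<open>\<zeta>\<^sup>n(1)\<close>. Since \<open>\<zeta>\<^sup>n\<^sup>+\<^sup>1(c)\<close> is a concatenation of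
  copies of \<open>\<zeta>\<^sup>n(0)\<close> and \<open>\<zeta>\<^sup>n(1)\<close>, the stripped words of one level are built from those of the previous
  level, provided at least two copies that contain a zero occur. If \<open>\<zeta>(1)\<close> contains a zero, this proviso
  holds after passing from \<open>\<zeta>\<close> to \<open>\<zeta>\<^sup>3\<close>, which has the same fixed point. If \<open>\<zeta>(1)\<close> is a power of \<open>1\<close>,
  then the iterates of \<open>1\<close> are mere spacers, and the only obstruction is \<open>\<zeta>(0) = 01\<^sup>m\<close>, whose fixed
  point is \<open>0111\<dots>\<close>.
\<close>

section \<open>Substitutions as monoid morphisms\<close>

lemma subst_word_simps [simp]:
  "subst_word \<zeta> [] = []"
  "subst_word \<zeta> (c # w) = \<zeta> c @ subst_word \<zeta> w"
  "subst_word \<zeta> (w @ w') = subst_word \<zeta> w @ subst_word \<zeta> w'"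
  by (simp_all add: subst_word_def)

lemma funpow_subst_word_Nil [simp]: "(subst_word \<zeta> ^^ n) [] = []"
  by (induction n) auto

lemma funpow_subst_word_append:
  "(subst_word \<zeta> ^^ n) (w @ w') = (subst_word \<zeta> ^^ n) w @ (subst_word \<zeta> ^^ n) w'"
  by (induction n) auto

lemma funpow_subst_word_conv_concat:
  "(subst_word \<zeta> ^^ n) w = concat (map (\<lambda>c. (subst_word \<zeta> ^^ n) [c]) w)"
proof (induction w)
  case (Cons c w)
  then show ?case
    using funpow_subst_word_append[of n \<zeta> "[c]" w] by simp
qed simp

text \<open>The innermost application of \<zeta> is unfolded, not the outermost: this presents a
  level n + 1 word as level n words in the order of the letters of \<open>\<zeta> c\<close>.\<close>

lemma funpow_subst_word_Suc_singleton:
  "(subst_word \<zeta> ^^ Suc n) [c] = concat (map (\<lambda>c. (subst_word \<zeta> ^^ n) [c]) (\<zeta> c))"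
  using funpow_subst_word_conv_concat[of n \<zeta> "\<zeta> c"] by (simp add: funpow_Suc_right del: funpow.simps)

lemma subst_word_funpow: "subst_word (\<lambda>c. (subst_word \<zeta> ^^ p) [c]) = subst_word \<zeta> ^^ p"
  by (rule ext) (subst funpow_subst_word_conv_concat, simp add: subst_word_def)

lemma hd_subst_word:
  assumes "hd (\<zeta> 0) = 0" "\<zeta> 0 \<noteq> []" "w \<noteq> []" "hd w = 0"
  shows "subst_word \<zeta> w \<noteq> []" "hd (subst_word \<zeta> w) = 0"
  using assms by (cases w; simp)+

lemma hd_funpow_subst_word:
  assumes "hd (\<zeta> 0) = 0" "\<zeta> 0 \<noteq> []"
  shows "(subst_word \<zeta> ^^ n) [0] \<noteq> [] \<and> hd ((subst_word \<zeta> ^^ n) [0]) = 0"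
  by (induction n) (use assms in \<open>auto simp: hd_subst_word\<close>)

lemma length_le_count_zeros_subst_word:
  assumes "\<And>c. 0 \<in> set (\<zeta> c)"
  shows "length w \<le> count_list (subst_word \<zeta> w) 0"
proof (induction w)
  case (Cons c w)
  have "count_list (\<zeta> c) 0 \<noteq> 0"
    using assms by (simp add: count_list_0_iff)
  with Cons show ?case
    by simp
qed simp

section \<open>Prefixes of a fixed point\<close>

lemma flat_smap_shift:
  assumes "\<And>c. \<zeta> c \<noteq> []"
  shows "flat (smap \<zeta> (w @- s)) = subst_word \<zeta> w @- flat (smap \<zeta> s)"
  by (induction w) (simp_all add: assms)

lemma fixed_point_prefix:
  assumes "\<And>c. \<zeta> c \<noteq> []" "subst_stream \<zeta> u = u" "u = w @- s"
  shows "\<exists>s'. u = (subst_word \<zeta> ^^ n) w @- s'"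
proof (induction n)
  case (Suc n)
  then obtain s' where s': "u = (subst_word \<zeta> ^^ n) w @- s'"
    by blast
  have "u = flat (smap \<zeta> u)"
    using assms(2) by (simp only: subst_stream_def)
  also have "\<dots> = subst_word \<zeta> ((subst_word \<zeta> ^^ n) w) @- flat (smap \<zeta> s')"
    unfolding s' using assms(1) by (rule flat_smap_shift)
  finally show ?case
    by auto
qed (use assms(3) in auto)

lemma initial_segment_shift: "initial_segment w (w @- s)"
  by (simp add: initial_segment_def stake_shift)

text \<open>A prefix 0 1^n' of u is mapped to the prefix 0 1^(m + 1 + n' k). Since k > 0, the run of
  ones gets strictly longer, so it is unbounded.\<close>

lemma zero_ones_if_single_zero:
  assumes ne: "\<And>c. \<zeta> c \<noteq> []" and fixed: "subst_stream \<zeta> u = u" and "shd u = 0"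
    and z0: "\<zeta> 0 = 0 # replicate (Suc m) 1" and z1: "\<zeta> 1 = replicate k 1"
  shows "u = 0 ## sconst 1"
proof -
  have pre: "\<exists>n'\<ge>n. \<exists>s. u = (0 # replicate n' 1) @- s" for n
  proof (induction n)
    case 0
    show ?case
      using assms(3) by (intro exI[of _ 0]) (auto intro!: exI[of _ "stl u"] simp: stream.expand)
  next
    case (Suc n)
    then obtain n' s where n': "n' \<ge> n" and s: "u = (0 # replicate n' 1) @- s"
      by blast
    have "k > 0"
      using ne[of 1] z1 by (cases k) auto
    have ones: "subst_word \<zeta> (replicate j 1) = replicate (j * k) 1" for j
      by (induction j) (auto simp: z1 replicate_add)
    obtain s' where "u = subst_word \<zeta> (0 # replicate n' 1) @- s'"
      using fixed_point_prefix[OF ne fixed s, of 1] by auto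
    then have "u = (0 # replicate (Suc m + n' * k) 1) @- s'"
      by (simp only: subst_word_simps z0 ones replicate_add append_Cons)
    moreover have "Suc m + n' * k \<ge> Suc n"
      using n' \<open>k > 0\<close> by (simp add: trans_le_add2 le_trans[of n n' "n' * k"])
    ultimately show ?case
      by blast
  qed
  have "u !! j = (0 ## sconst 1) !! j" for j
  proof -
    obtain n' s where n': "n' \<ge> j" and s: "u = (0 # replicate n' 1) @- s"
      using pre by blast
    show ?thesis
    proof (cases j)
      case (Suc i)
      then show ?thesis
        using n' by (simp add: s)
    qed (simp add: s)
  qed
  \<comment> \<open>With \<open>id\<close> for the mapped function, \<open>smap_alt\<close> serves
    as extensionality of streams.\<close>
  then show ?thesis
    using smap_alt[of id u "0 ## sconst 1"] by (simp add: stream.map_id)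
qed

section \<open>Stripping outer ones\<close>

definition strip :: "bit list \<Rightarrow> bit list" where
  "strip w = rev (dropWhile ((=) 1) (rev (dropWhile ((=) 1) w)))"

lemma dropWhile_replicate_append: "dropWhile ((=) x) (replicate n x @ w) = dropWhile ((=) x) w"
  by (induction n) auto

lemma takeWhile_eq_replicate: "\<exists>n. takeWhile ((=) x) w = replicate n x"
proof -
  have "\<forall>y\<in>set (takeWhile ((=) x) w). y = x"
    by (auto dest: set_takeWhileD)
  then show ?thesis
    using replicate_length_same by metis
qed

text \<open>Uniqueness half of the factorization into ones, a zero-ended word and ones;
  \<open>strip_decompose\<close> is the existence half. It evaluates \<open>strip\<close> on any
  such factorization.\<close>

lemma strip_eq:
  assumes "y \<in> zero_ended_words"
  shows "strip (replicate b 1 @ y @ replicate a 1) = y"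
proof -
  from assms obtain z where z: "y = 0 # z"
    by (cases y) (auto simp: zero_ended_words_def)
  from assms obtain z' where z': "rev y = 0 # z'"
    by (cases "rev y") (auto simp: zero_ended_words_def last_rev hd_rev[symmetric])
  have "dropWhile ((=) 1) (replicate b 1 @ y @ replicate a 1) = y @ replicate a 1"
    unfolding dropWhile_replicate_append by (simp add: z)
  moreover have "dropWhile ((=) 1) (rev (y @ replicate a 1)) = rev y"
    unfolding rev_append rev_replicate dropWhile_replicate_append by (simp add: z')
  ultimately show ?thesis
    by (simp add: strip_def)
qed

lemma strip_decompose:
  assumes "0 \<in> set w"
  obtains b a where "w = replicate b 1 @ strip w @ replicate a 1" "strip w \<in> zero_ended_words"
proof -
  define x where "x = dropWhile ((=) 1) w"
  define y where "y = dropWhile ((=) 1) (rev x)"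
  obtain b where b: "w = replicate b 1 @ x"
    using takeWhile_dropWhile_id[of "(=) 1" w] takeWhile_eq_replicate[of 1 w] x_def by metis
  obtain a where a: "rev x = replicate a 1 @ y"
    using takeWhile_dropWhile_id[of "(=) 1" "rev x"] takeWhile_eq_replicate[of 1 "rev x"] y_def
    by metis
  have sy: "strip w = rev y"
    by (simp add: strip_def x_def y_def)
  have xa: "x = rev y @ replicate a 1"
    using arg_cong[OF a, of rev] by simp
  have "0 \<in> set x"
    using assms b by auto
  then have "0 \<in> set y"
    using a by (metis Un_iff in_set_replicate set_append set_rev zero_neq_one)
  then have "y \<noteq> []" "x \<noteq> []"
    using xa by auto
  have "hd y \<noteq> 1"
    using hd_dropWhile[of "(=) 1" "rev x"] \<open>y \<noteq> []\<close> y_def by auto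
  moreover have "hd x \<noteq> 1"
    using hd_dropWhile[of "(=) 1" w] \<open>x \<noteq> []\<close> x_def by auto
  ultimately have "rev y \<in> zero_ended_words"
    using \<open>y \<noteq> []\<close> xa by (auto simp: zero_ended_words_def last_rev)
  then show thesis
    using that b xa sy by simp
qed

text \<open>A leading zero leaves nothing to strip on the left, so the stripped word is a prefix.
  This is what makes the first words of the construction initial segments of u.\<close>

lemma strip_decompose_hd:
  assumes "w \<noteq> []" "hd w = 0"
  obtains a where "w = strip w @ replicate a 1" "strip w \<in> zero_ended_words"
proof -
  have "0 \<in> set w"
    using assms by (metis hd_in_set)
  then obtain b a where ba: "w = replicate b 1 @ strip w @ replicate a 1" "strip w \<in> zero_ended_words"
    by (rule strip_decompose)
  have "b = 0"
  proof (rule ccontr)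
    assume "b \<noteq> 0"
    then have "hd (replicate b (1::bit) @ strip w @ replicate a 1) = 1"
      by (cases b) auto
    then show False
      using ba(1) assms(2) by simp
  qed
  then show thesis
    using that ba by simp
qed

section \<open>Concatenations of blocks and ones\<close>

text \<open>A relaxation of \<open>built_from\<close> that allows ones at both ends and any number n
  of blocks. Unlike \<open>spacer_decomposition\<close> it is closed under concatenation, with block
  counts adding up.\<close>

inductive blocks :: "bit list set \<Rightarrow> nat \<Rightarrow> bit list \<Rightarrow> bool" for S where
  Nil: "blocks S 0 []"
| one: "blocks S n w \<Longrightarrow> blocks S n (1 # w)"
| block: "v \<in> S \<Longrightarrow> blocks S n w \<Longrightarrow> blocks S (Suc n) (v @ w)"

lemma blocks_append: "blocks S m w \<Longrightarrow> blocks S n w' \<Longrightarrow> blocks S (m + n) (w @ w')"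
  by (induction rule: blocks.induct) (auto intro: blocks.intros)

lemma blocks_ones: "blocks S 0 (replicate a 1)"
  by (induction a) (auto intro: blocks.intros)

lemma blocks_spaced: "v \<in> S \<Longrightarrow> blocks S (Suc 0) (replicate b 1 @ v @ replicate a 1)"
  using blocks_append[OF blocks_ones blocks.block[OF _ blocks_ones]] by force

text \<open>Only \<open>f 0\<close> is sure to contribute a block, since \<open>f 1\<close> may
  consist of spacers; hence the bound by the number of zeros of w.\<close>

lemma blocks_concat:
  fixes f :: "bit \<Rightarrow> bit list"
  assumes "\<exists>n\<ge>1. blocks S n (f 0)" and "\<exists>n. blocks S n (f 1)"
  shows "\<exists>n\<ge>count_list w 0. blocks S n (concat (map f w))"
proof (induction w)
  case (Cons c w)
  then obtain n where n: "n \<ge> count_list w 0" "blocks S n (concat (map f w))"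
    by blast
  have "\<exists>m\<ge>(if c = 0 then 1 else 0). blocks S m (f c)"
    using assms by (cases c) auto
  then obtain m where m: "m \<ge> (if c = 0 then 1 else 0)" "blocks S m (f c)"
    by blast
  show ?case
    using n m blocks_append[OF m(2) n(2)] by (intro exI[of _ "m + n"]) (auto split: if_splits)
qed (auto intro: blocks.intros)

text \<open>Each run of ones is charged to the block before it. Only the leading run b has no such
  block, and it becomes an exponent once a block is put in front.\<close>

lemma blocks_split:
  assumes "blocks S n w"
  shows "\<exists>b ps. length ps = n \<and> fst ` set ps \<subseteq> S \<and>
    w = replicate b 1 @ concat (map (\<lambda>(v, a). v @ replicate a 1) ps)"
  using assms
proof (induction rule: blocks.induct)
  case Nil
  show ?case
    by (intro exI[of _ 0] exI[of _ "[]"]) simp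
next
  case (one n w)
  then obtain b ps where "length ps = n" "fst ` set ps \<subseteq> S"
    "w = replicate b 1 @ concat (map (\<lambda>(v, a). v @ replicate a 1) ps)"
    by blast
  then show ?case
    by (intro exI[of _ "Suc b"] exI[of _ ps]) simp
next
  case (block v n w)
  then obtain b ps where "length ps = n" "fst ` set ps \<subseteq> S"
    "w = replicate b 1 @ concat (map (\<lambda>(v, a). v @ replicate a 1) ps)"
    by blast
  then show ?case
    using block.hyps by (intro exI[of _ 0] exI[of _ "(v, b) # ps"]) simp
qed

text \<open>Together with x there are n + 1 blocks, so k = n is admissible. Stripping removes just
  the b leading ones and the run after the last block; the inner runs are the exponents.\<close>

lemma built_from_starting_with_strip_blocks:
  assumes S: "S \<subseteq> zero_ended_words" and "x \<in> S" and "blocks S n w" and "n \<ge> 1"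
  shows "built_from_starting_with S x (strip (replicate b 1 @ x @ w))"
proof -
  define f :: "bit list \<times> nat \<Rightarrow> bit list" where "f = (\<lambda>(v, a). v @ replicate a 1)"
  obtain b' ps where ps: "length ps = n" "fst ` set ps \<subseteq> S" "w = replicate b' 1 @ concat (map f ps)"
    using blocks_split[OF assms(3)] unfolding f_def by blast
  define qs where "qs = (x, b') # ps"
  define y where "y = concat (map f (take n qs)) @ fst (qs ! n)"
  have len: "length qs = Suc n"
    by (simp add: qs_def ps)
  have mem: "fst (qs ! i) \<in> S" if "i < Suc n" for i
  proof -
    have "qs ! i \<in> set qs"
      using that len by simp
    then show ?thesis
      using ps(2) \<open>x \<in> S\<close> by (auto simp: qs_def)
  qed
  have "x @ w = concat (map f qs)"
    by (simp add: qs_def ps f_def)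
  also have "qs = take n qs @ [qs ! n]"
    using take_Suc_conv_app_nth[of n qs] len by simp
  also have "concat (map f \<dots>) = y @ replicate (snd (qs ! n)) 1"
    by (simp add: y_def f_def split: prod.splits)
  finally have xw: "x @ w = y @ replicate (snd (qs ! n)) 1" .
  obtain z where z: "y = x @ z"
    using \<open>n \<ge> 1\<close> by (cases n) (auto simp: y_def qs_def f_def)
  have "x \<in> zero_ended_words" "fst (qs ! n) \<in> zero_ended_words"
    using S \<open>x \<in> S\<close> mem[of n] by auto
  then have "hd y = 0" "last y = 0" "y \<noteq> []"
    by (simp_all add: z zero_ended_words_def) (simp add: z[symmetric] y_def)
  then have "y \<in> zero_ended_words"
    by (simp add: zero_ended_words_def)
  then have strip: "strip (replicate b 1 @ x @ w) = y"
    unfolding xw by (rule strip_eq)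
  \<comment> \<open>Decompositions are indexed from 1, the list \<open>qs\<close> from 0.\<close>
  have "map (\<lambda>i. fst (qs ! (i - 1)) @ replicate (snd (qs ! (i - 1))) 1) [1..<n+1] = map f (take n qs)"
    by (rule nth_equalityI) (auto simp: len f_def case_prod_beta simp del: upt_Suc)
  then have "spacer_decomposition S y n (\<lambda>i. fst (qs ! (i - 1))) (\<lambda>i. snd (qs ! (i - 1)))"
    unfolding spacer_decomposition_def using \<open>n \<ge> 1\<close> mem by (auto simp: y_def simp del: upt_Suc)
  then show ?thesis
    unfolding strip built_from_starting_with_def by (force simp: qs_def)
qed

lemma built_from_if_starting_with: "built_from_starting_with S x w \<Longrightarrow> built_from S w"
  unfolding built_from_starting_with_def built_from_def by blast

lemma blocks_first:
  assumes "blocks S n w" "n > 0"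
  shows "\<exists>b x w'. x \<in> S \<and> w = replicate b 1 @ x @ w' \<and> blocks S (n - 1) w'"
  using assms
proof (induction rule: blocks.induct)
  case (one n w)
  then obtain b x w' where "x \<in> S" "w = replicate b 1 @ x @ w'" "blocks S (n - 1) w'"
    by blast
  then show ?case
    by (intro exI[of _ "Suc b"] exI[of _ x] exI[of _ w']) simp
next
  case (block v n w)
  then show ?case
    by (intro exI[of _ 0] exI[of _ v] exI[of _ w]) simp
qed simp

text \<open>One of the two blocks serves as the starting word; the other meets the demand k \<ge>
  1.\<close>

lemma built_from_strip_blocks:
  assumes "S \<subseteq> zero_ended_words" and "blocks S n w" and "n \<ge> 2"
  shows "built_from S (strip w)"
proof -
  obtain b x w' where "x \<in> S" "w = replicate b 1 @ x @ w'" "blocks S (n - 1) w'"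
    using blocks_first[OF assms(2)] assms(3) by auto
  moreover have "n - 1 \<ge> 1"
    using assms(3) by simp
  ultimately show ?thesis
    using built_from_starting_with_strip_blocks[OF assms(1)] built_from_if_starting_with by metis
qed

section \<open>Rank-two constructions from stripped iterates\<close>

text \<open>Two zeros in \<eta>(c) give at least two blocks of level i in \<eta>^(i+1)(c), as
  \<open>built_from\<close> requires. If \<eta>(1) has only ones, so do all iterates of 1, and no
  separate second word arises.\<close>

lemma at_most_spacer_rank_two_if_two_zeros:
  assumes hd0: "hd (\<eta> 0) = 0" and two0: "count_list (\<eta> 0) 0 \<ge> 2"
    and \<eta>1: "set (\<eta> 1) \<subseteq> {1} \<or> count_list (\<eta> 1) 0 \<ge> 2"
    and pre: "\<And>i. \<exists>s. u = (subst_word \<eta> ^^ i) [0] @- s"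
  shows "at_most_spacer_rank 2 u"
proof -
  define W where "W i c = (subst_word \<eta> ^^ i) [c]" for i c
  text \<open>If \<open>\<eta>\<^sup>i(1)\<close> has no zero, in particular for \<open>i = 0\<close>, the second word repeats the first.\<close>
  define v where "v i j = strip (W i (if j = 2 \<and> 0 \<in> set (W i 1) then 1 else 0))" for i and j :: nat
  define S where "S i = v i ` {1..2}" for i
  have W_Suc: "W (Suc i) c = concat (map (W i) (\<eta> c))" for i c
    unfolding W_def by (rule funpow_subst_word_Suc_singleton)
  have ne0: "\<eta> 0 \<noteq> []"
    using two0 by auto
  have W0: "W i 0 \<noteq> []" "hd (W i 0) = 0" for i
    using hd_funpow_subst_word[of \<eta> i, OF hd0 ne0] by (simp_all add: W_def)
  have v1: "v i 1 = strip (W i 0)" for i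
    by (simp add: v_def)
  have S_mem: "v i 1 \<in> S i" "v i 2 \<in> S i" for i
    by (auto simp: S_def)
  have S_zero_ended: "S i \<subseteq> zero_ended_words" for i
  proof -
    have "strip w \<in> zero_ended_words" if "0 \<in> set w" for w
      using that by (rule strip_decompose)
    moreover have "0 \<in> set (W i 0)"
      using W0[of i] by (metis hd_in_set)
    ultimately show ?thesis
      by (auto simp: S_def v_def)
  qed
  have blocks0: "\<exists>n\<ge>1. blocks (S i) n (W i 0)" for i
  proof -
    obtain a where "W i 0 = strip (W i 0) @ replicate a 1"
      using strip_decompose_hd[OF W0] by metis
    then show ?thesis
      using blocks_spaced[OF S_mem(1)[of i], of 0 a] v1[of i] by auto
  qed
  have blocks1: "\<exists>n. blocks (S i) n (W i 1)" for i
  proof (cases "0 \<in> set (W i 1)")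
    case True
    then obtain b a where "W i 1 = replicate b 1 @ strip (W i 1) @ replicate a 1"
      by (rule strip_decompose)
    moreover have "v i 2 = strip (W i 1)"
      using True by (simp add: v_def)
    ultimately show ?thesis
      using blocks_spaced[OF S_mem(2)[of i], of b a] by auto
  next
    case False
    then have "\<forall>x\<in>set (W i 1). x = 1"
      by (metis bit.exhaust)
    then have "W i 1 = replicate (length (W i 1)) 1"
      by (metis replicate_length_same)
    then show ?thesis
      using blocks_ones by metis
  qed
  have blocks_concat_W: "\<exists>n\<ge>count_list w 0. blocks (S i) n (concat (map (W i) w))" for i w
    using blocks0 blocks1 by (rule blocks_concat)
  have start: "built_from_starting_with (S i) (v i 1) (v (i + 1) 1)" for i
  proof -
    \<comment> \<open>The leading 0 makes the next iterate start with \<open>W i 0\<close>, hence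
      with \<open>v i 1\<close>; the second zero of \<open>\<eta> 0\<close> lies in w and yields the
      further block.\<close>
    obtain w where w: "\<eta> 0 = 0 # w"
      using hd0 ne0 by (cases "\<eta> 0") auto
    obtain a where a: "W i 0 = v i 1 @ replicate a 1"
      using strip_decompose_hd[OF W0] v1 by metis
    obtain n where n: "n \<ge> count_list w 0" "blocks (S i) n (concat (map (W i) w))"
      using blocks_concat_W by blast
    have "W (Suc i) 0 = v i 1 @ replicate a 1 @ concat (map (W i) w)"
      by (simp add: W_Suc w a)
    moreover have "blocks (S i) n (replicate a 1 @ concat (map (W i) w))"
      using blocks_append[OF blocks_ones n(2)] by simp
    moreover have "n \<ge> 1"
      using n(1) two0 w by simp
    ultimately show ?thesis
      using built_from_starting_with_strip_blocks[OF S_zero_ended S_mem(1), of i n _ 0] v1[of "Suc i"]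
      by simp
  qed
  have second: "built_from (S i) (v (i + 1) 2)" for i
  proof (cases "0 \<in> set (W (Suc i) 1)")
    case True
    have "\<not> set (\<eta> 1) \<subseteq> {1}"
    proof
      assume *: "set (\<eta> 1) \<subseteq> {1}"
      have "set (W j 1) \<subseteq> {1}" for j
      proof (induction j)
        case (Suc j)
        then show ?case
          using * by (fastforce simp: W_Suc)
      qed (simp add: W_def)
      with True show False
        by fastforce
    qed
    with \<eta>1 have "count_list (\<eta> 1) 0 \<ge> 2"
      by blast
    then obtain n where "n \<ge> 2" "blocks (S i) n (W (Suc i) 1)"
      using blocks_concat_W[where w = "\<eta> 1" and i = i] order_trans unfolding W_Suc by blast
    moreover have "v (i + 1) 2 = strip (W (Suc i) 1)"
      using True by (simp add: v_def)
    ultimately show ?thesis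
      using built_from_strip_blocks[OF S_zero_ended] by simp
  next
    case False
    then have "v (i + 1) 2 = v (i + 1) 1"
      by (simp add: v_def)
    then show ?thesis
      using start built_from_if_starting_with by metis
  qed
  have initial: "initial_segment (v i 1) u" for i
  proof -
    obtain s where s: "u = W i 0 @- s"
      using pre W_def by metis
    obtain a where "W i 0 = v i 1 @ replicate a 1"
      using strip_decompose_hd[OF W0] v1 by metis
    with s have "u = v i 1 @- replicate a 1 @- s"
      by simp
    then show ?thesis
      using initial_segment_shift by metis
  qed
  have "v 0 j = [0]" for j
    by (simp add: v_def W_def strip_def)
  moreover have "j = 2" if "j \<in> {2..2}" for j :: nat
    using that by simp
  ultimately show ?thesis
    unfolding at_most_spacer_rank_def using S_zero_ended start second initial
    by (intro exI[of _ "\<lambda>_. 2"] exI[of _ v]) (auto simp: S_def)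
qed

theorem proposition3p2:
  fixes \<zeta> :: "bit \<Rightarrow> bit list" and u :: "bit stream"
  assumes zeta0_starts: "hd (\<zeta> 0) = 0"
    and zeta0_length: "length (\<zeta> 0) > 1"
    and zeta1_grows: "filterlim (\<lambda>n. length ((subst_word \<zeta> ^^ n) [1])) at_top sequentially"
    and u_starts: "shd u = 0"
    and u_fixed: "subst_stream \<zeta> u = u"
    and u_nondegenerate: "u \<noteq> 0 ## sconst 1"
  shows "at_most_spacer_rank 2 u"
proof -
  have ne0: "\<zeta> 0 \<noteq> []"
    using zeta0_length by auto
  \<comment> \<open>An empty image would make all later iterates of 1 empty, against their
    growth.\<close>
  have ne1: "\<zeta> 1 \<noteq> []"
  proof
    assume "\<zeta> 1 = []"
    then have "(subst_word \<zeta> ^^ Suc n) [1] = []" for n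
      by (simp add: funpow_Suc_right del: funpow.simps)
    moreover obtain N where "\<And>n. n \<ge> N \<Longrightarrow> length ((subst_word \<zeta> ^^ n) [1]) \<ge> 1"
      using zeta1_grows unfolding filterlim_at_top eventually_sequentially by meson
    then have "length ((subst_word \<zeta> ^^ Suc N) [1]) \<ge> 1"
      using le_SucI by blast
    ultimately show False
      by simp
  qed
  have ne: "\<zeta> c \<noteq> []" for c
    using ne0 ne1 by (cases c) auto
  have "u = [0] @- stl u"
    using u_starts by (metis shift.simps stream.collapse)
  then have pre: "\<exists>s. u = (subst_word \<zeta> ^^ n) [0] @- s" for n
    by (rule fixed_point_prefix[OF ne u_fixed])
  obtain w where w: "\<zeta> 0 = 0 # w"
    using zeta0_starts ne0 by (cases "\<zeta> 0") auto
  show ?thesis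
  proof (cases "0 \<in> set (\<zeta> 1)")
    case False
    then have "\<forall>x\<in>set (\<zeta> 1). x = 1"
      by (metis bit.exhaust)
    \<comment> \<open>Otherwise \<zeta>(0) is 0 followed by ones, and u is the excluded word
      0111...\<close>
    have "0 \<in> set w"
    proof (rule ccontr)
      assume "0 \<notin> set w"
      then have "w = replicate (length w) 1"
        by (metis bit.exhaust replicate_length_same)
      moreover have "length w = Suc (length w - 1)"
        using zeta0_length w by simp
      ultimately have "\<zeta> 0 = 0 # replicate (Suc (length w - 1)) 1"
        using w by metis
      moreover have "\<zeta> 1 = replicate (length (\<zeta> 1)) 1"
        using \<open>\<forall>x\<in>set (\<zeta> 1). x = 1\<close> by (metis replicate_length_same)
      ultimately show False
        using zero_ones_if_single_zero[OF ne u_fixed u_starts] u_nondegenerate by blast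
    qed
    then have "count_list w 0 \<noteq> 0"
      by (simp add: count_list_0_iff)
    then have "count_list (\<zeta> 0) 0 \<ge> 2"
      by (simp add: w)
    then show ?thesis
      using at_most_spacer_rank_two_if_two_zeros[OF zeta0_starts _ _ pre]
        \<open>\<forall>x\<in>set (\<zeta> 1). x = 1\<close> by blast
  next
    case True
    \<comment> \<open>One application of \<zeta> gives a zero, the second turns that zero into at
      least two letters, the third puts a zero into the image of each letter. The square can fail: 0
      -> 01, 1 -> 0 has \<zeta>^2(1) = 01.\<close>
    define \<eta> where "\<eta> c = (subst_word \<zeta> ^^ 3) [c]" for c
    have \<eta>: "\<eta> c = subst_word \<zeta> (subst_word \<zeta> (\<zeta> c))" for c
      by (simp add: \<eta>_def numeral_3_eq_3)
    have zero: "0 \<in> set (\<zeta> c)" for c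
      using True w by (cases c) auto
    have len: "2 \<le> length (subst_word \<zeta> (\<zeta> c))" for c
    proof -
      obtain x y where "\<zeta> c = x @ 0 # y"
        using split_list[OF zero] by metis
      then show ?thesis
        using zeta0_length by simp
    qed
    have two: "2 \<le> count_list (\<eta> c) 0" for c
      unfolding \<eta> using len length_le_count_zeros_subst_word[OF zero] by (rule order_trans)
    have "\<exists>s. u = (subst_word \<eta> ^^ i) [0] @- s" for i
    proof -
      have "subst_word \<eta> = subst_word \<zeta> ^^ 3"
        unfolding \<eta>_def by (rule subst_word_funpow)
      then show ?thesis
        using pre[of "3 * i"] by (simp add: funpow_mult)
    qed
    moreover have "hd (\<eta> 0) = 0"
      using hd_funpow_subst_word[of \<zeta> 3, OF zeta0_starts ne0] by (simp add: \<eta>_def)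
    ultimately show ?thesis
      using two by (intro at_most_spacer_rank_two_if_two_zeros) auto
  qed
qed

end
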